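(* Let $X,Y$ be real nonzero Banach spaces, $S:X\rightrightarrows X^*$ and $T:Y\rightrightarrows Y^*$ maximal monotone operators of Gossez type (D) with strong representative functions $h_S,h_T$, and $A:X\to Y$ linear continuous with $\big(\operatorname{dom}h_T\times\operatorname{pr}_{X^*}(\operatorname{dom}h_S)\big)\cap\big(\operatorname{im}A\times\Delta_{Y^*}^{A^*}\big)\neq\emptyset$. Then $${}^{ic}\big(G(T)\times R(S)-\operatorname{im}A\times\Delta_{Y^*}^{A^*}\big)\subseteq{}^{ic}\big(\operatorname{co}G(T)\times\operatorname{co}R(S)-\operatorname{im}A\times\Delta_{Y^*}^{A^*}\big)\subseteq{}^{ic}\big(\operatorname{dom}h_T\times\operatorname{pr}_{X^*}(\operatorname{dom}h_S)-\operatorname{im}A\times\Delta_{Y^*}^{A^*}\big)=\operatorname{ri}\big(\operatorname{dom}h_T\times\operatorname{pr}_{X^*}(\operatorname{dom}h_S)-\operatorname{im}A\times\Delta_{Y^*}^{A^*}\big).$$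
   Context: $G(M)$, $R(M)$ are graph and range of an operator; $\operatorname{co}$ is convex hull. Coupling $c(x,x^* )=\langle x^*,x\rangle$; $X$ identified with its image in $X^{**}$. Conjugate of $h$ on $X\times X^*$: $h^*(x^*,x^{**})=\sup_{(x,y^* )}\{\langle x^*,x\rangle+\langle x^{**},y^*\rangle-h(x,y^* )\}$. A representative function of a monotone $S$ is a convex norm-lsc $h_S$ with $h_S\ge c$ and $G(S)\subseteq\{h_S=c\}$; strong if $h_S^*(x^*,x^{**})\ge\langle x^{**},x^*\rangle$ for all. Gossez's closure $\overline S$ has graph $\{(x^{**},x^* )\in X^{**}\times X^*:\langle x^{**}-y,x^*-y^*\rangle\ge0\ \forall(y,y^* )\in G(S)\}$; maximal monotone $S$ is of Gossez type (D) if each point of $G(\overline S)$ is the $w^*\times\|\cdot\|_*$-limit of a bounded net in $G(S)$. $\operatorname{im}A=A(X)$; $\Delta_{Y^*}^{A^*}=\{(y^*,A^*y^* ):y^*\in Y^*\}$; sets are in $Y\times Y^*\times X^*$. For a set $D$: $\operatorname{icr}D=\{u:\forall x\in\operatorname{aff}(D-D)\ \exists\delta>0\ \forall\lambda\in[0,\delta]:u+\lambda x\in D\}$; ${}^{ic}D=\operatorname{icr}D$ if $\operatorname{aff}D$ is closed, else $\emptyset$; $\operatorname{ri}D$ is the interior of $D$ relative to $\operatorname{aff}D$ if $\operatorname{aff}D$ is closed, else $\emptyset$. *)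

theory Defs
  imports "HOL-Analysis.Analysis"
begin

text \<open>Dual space of a real normed space: continuous linear functionals.
  Bidual: continuous linear functionals on the dual.  A multivalued operator
  S : X \<rightrightarrows> X* is identified with its graph G(S), a subset of X \<times> X*.\<close>

type_synonym 'a dual = "'a \<Rightarrow>\<^sub>L real"
type_synonym 'a bidual = "('a \<Rightarrow>\<^sub>L real) \<Rightarrow>\<^sub>L real"

definition coupling :: "'a::real_normed_vector \<times> 'a dual \<Rightarrow> real" where
  "coupling p = blinfun_apply (snd p) (fst p)"

definition monotone_op :: "('a::real_normed_vector \<times> 'a dual) set \<Rightarrow> bool" where
  "monotone_op G \<longleftrightarrow> (\<forall>(x, xs) \<in> G. \<forall>(y, ys) \<in> G. 0 \<le> blinfun_apply (xs - ys) (x - y))"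

definition maximal_monotone :: "('a::real_normed_vector \<times> 'a dual) set \<Rightarrow> bool" where
  "maximal_monotone G \<longleftrightarrow> monotone_op G \<and> (\<forall>G'. monotone_op G' \<and> G \<subseteq> G' \<longrightarrow> G' = G)"

definition range_op :: "('a \<times> 'b) set \<Rightarrow> 'b set" where
  "range_op G = snd ` G"

definition gossez_closure :: "('a::real_normed_vector \<times> 'a dual) set \<Rightarrow> ('a bidual \<times> 'a dual) set" where
  "gossez_closure G = {(x2, xs). \<forall>(y, ys) \<in> G. 0 \<le> blinfun_apply x2 (xs - ys) - blinfun_apply (xs - ys) y}"

text \<open>Maximal monotone of Gossez type (D): every point of the Gossez closure is the
  (weak-star in X**) \<times> (norm in X*)-limit of a bounded net in G(S).  Nets are rendered
  as a proper filter F on X \<times> X* (the net being the identity, indexed by F), eventually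
  lying in G(S) and in a bounded set.\<close>
definition gossez_D :: "('a::real_normed_vector \<times> 'a dual) set \<Rightarrow> bool" where
  "gossez_D G \<longleftrightarrow> maximal_monotone G \<and>
     (\<forall>(x2, xs) \<in> gossez_closure G. \<exists>F M.
        F \<noteq> bot \<and>
        eventually (\<lambda>p. p \<in> G \<and> norm (fst p) \<le> M \<and> norm (snd p) \<le> M) F \<and>
        (\<forall>f. ((\<lambda>p. blinfun_apply f (fst p)) \<longlongrightarrow> blinfun_apply x2 f) F) \<and>
        ((\<lambda>p. snd p) \<longlongrightarrow> xs) F)"

definition edom :: "('a \<Rightarrow> ereal) \<Rightarrow> 'a set" where
  "edom h = {p. h p < \<infinity>}"

definition ereal_convex :: "('a::real_vector \<Rightarrow> ereal) \<Rightarrow> bool" where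
  "ereal_convex h \<longleftrightarrow> convex {(p, r::real). h p \<le> ereal r}"

definition ereal_lsc :: "('a::topological_space \<Rightarrow> ereal) \<Rightarrow> bool" where
  "ereal_lsc h \<longleftrightarrow> (\<forall>r::real. closed {p. h p \<le> ereal r})"

definition conj_rep :: "('a::real_normed_vector \<times> 'a dual \<Rightarrow> ereal) \<Rightarrow> 'a dual \<times> 'a bidual \<Rightarrow> ereal" where
  "conj_rep h q = (SUP p. ereal (blinfun_apply (fst q) (fst p) + blinfun_apply (snd q) (snd p)) - h p)"

definition representative :: "('a::real_normed_vector \<times> 'a dual) set \<Rightarrow> ('a \<times> 'a dual \<Rightarrow> ereal) \<Rightarrow> bool" where
  "representative G h \<longleftrightarrow> ereal_convex h \<and> ereal_lsc h \<and>
     (\<forall>p. ereal (coupling p) \<le> h p) \<and> G \<subseteq> {p. h p = ereal (coupling p)}"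

definition strong_representative :: "('a::real_normed_vector \<times> 'a dual) set \<Rightarrow> ('a \<times> 'a dual \<Rightarrow> ereal) \<Rightarrow> bool" where
  "strong_representative G h \<longleftrightarrow> representative G h \<and>
     (\<forall>xs x2. ereal (blinfun_apply x2 xs) \<le> conj_rep h (xs, x2))"

definition mdiff :: "'a::ab_group_add set \<Rightarrow> 'a set \<Rightarrow> 'a set" where
  "mdiff D E = {d - e | d e. d \<in> D \<and> e \<in> E}"

definition icr :: "'a::real_vector set \<Rightarrow> 'a set" where
  "icr D = {u. \<forall>x \<in> affine hull (mdiff D D). \<exists>\<delta>>0. \<forall>t\<in>{0..\<delta>}. u + t *\<^sub>R x \<in> D}"

definition ic :: "'a::real_normed_vector set \<Rightarrow> 'a set" where
  "ic D = (if closed (affine hull D) then icr D else {})"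

definition ri :: "'a::real_normed_vector set \<Rightarrow> 'a set" where
  "ri D = (if closed (affine hull D) then rel_interior D else {})"

definition prod3 :: "('b \<times> 'c) set \<Rightarrow> 'a set \<Rightarrow> ('b \<times> 'c \<times> 'a) set" where
  "prod3 P Q = {(y, ys, xs) | y ys xs. (y, ys) \<in> P \<and> xs \<in> Q}"

definition imA_Delta :: "('a::real_normed_vector \<Rightarrow>\<^sub>L 'b::real_normed_vector) \<Rightarrow> ('b \<times> 'b dual \<times> 'a dual) set" where
  "imA_Delta A = {(blinfun_apply A x, ys, ys o\<^sub>L A) | x ys. True}"

end

theory Submission
  imports Defs
begin

text \<open>A continuous functional constant on \<open>G(T) \<times> R(S) - im A \<times> \<Delta>\<close> vanishes on the linear space
  \<open>im A \<times> \<Delta>\<close>, so its restriction \<open>(b\<^sup>*, b\<^sup>*\<^sup>*)\<close> to \<open>Y \<times> Y\<^sup>*\<close> satisfies \<open>\<langle>b\<^sup>*\<^sup>*, b\<^sup>*\<rangle> = 0\<close>.  Translating a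
  point of \<open>G(T)\<close> along this isotropic direction stays in the Gossez closure; type (D) and
  \<open>h\<^sub>T \<ge>\<close> Fitzpatrick function then force the functional to be constant on \<open>dom h\<^sub>T\<close> as well.
  By Hahn--Banach the three difference sets have the same affine hull as soon as the smaller ones have a
  closed one, which gives the inclusions.  The equality of \<open>ic\<close> and \<open>ri\<close> is an open mapping argument: the
  set built from the domains is a continuous linear image of an increasing union of closed convex
  sublevel sets.\<close>

subsection \<open>Hahn--Banach separation\<close>

definition sublinear :: "('a::real_vector \<Rightarrow> real) \<Rightarrow> bool" where
  "sublinear q \<longleftrightarrow> (\<forall>x y. q (x + y) \<le> q x + q y) \<and> (\<forall>c x. 0 < c \<longrightarrow> q (c *\<^sub>R x) = c * q x)"

text \<open>The shift is a sublinear minorant of \<open>q\<close> with value at most \<open>- q a\<close> at \<open>- a\<close>.  A minimal sublinear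
  functional equals all its shifts, which makes it additive.\<close>
definition sublinear_shift :: "('a::real_vector \<Rightarrow> real) \<Rightarrow> 'a \<Rightarrow> 'a \<Rightarrow> real" where
  "sublinear_shift q a x = (INF t\<in>{0..}. q (x + t *\<^sub>R a) - t * q a)"

lemma sublinear_add: "sublinear q \<Longrightarrow> q (x + y) \<le> q x + q y"
  and sublinear_scale: "sublinear q \<Longrightarrow> 0 < c \<Longrightarrow> q (c *\<^sub>R x) = c * q x"
  by (auto simp: sublinear_def)

lemma sublinear_zero: "sublinear q \<Longrightarrow> q 0 = 0"
  using sublinear_scale[of q 2 0] by simp

lemma sublinear_minus: "sublinear q \<Longrightarrow> - q (- x) \<le> q x"
  using sublinear_add[of q x "- x"] sublinear_zero[of q] by simp

text \<open>The bound is free of \<open>t\<close>, so the infimum defining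
  \<open>sublinear_shift\<close> runs over a set bounded below.\<close>

lemma sublinear_shift_bound:
  assumes q: "sublinear q" and t: "0 \<le> t"
  shows "- q (- x) \<le> q (x + t *\<^sub>R a) - t * q a"
proof -
  have "t * q a = q (t *\<^sub>R a)"
    using t sublinear_scale[OF q, of t a] sublinear_zero[OF q] by (cases "t = 0") auto
  also have "\<dots> \<le> q (x + t *\<^sub>R a) + q (- x)"
    using sublinear_add[OF q, of "x + t *\<^sub>R a" "- x"] by simp
  finally show ?thesis by simp
qed

lemma sublinear_shift_le:
  assumes q: "sublinear q" and t: "0 \<le> t"
  shows "sublinear_shift q a x \<le> q (x + t *\<^sub>R a) - t * q a"
  unfolding sublinear_shift_def
  by (intro cINF_lower bdd_belowI2[of _ "- q (- x)"]) (use t sublinear_shift_bound[OF q] in auto)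

lemma sublinear_shift_greatest:
  assumes "\<And>t. 0 \<le> t \<Longrightarrow> m \<le> q (x + t *\<^sub>R a) - t * q a"
  shows "m \<le> sublinear_shift q a x"
  unfolding sublinear_shift_def by (intro cINF_greatest) (use assms in auto)

text \<open>Parameters \<open>t\<close> for \<open>x\<close> and \<open>u\<close> for
  \<open>y\<close> add up to an admissible parameter \<open>t + u\<close> for \<open>x + y\<close>;
  homogeneity comes from rescaling \<open>t\<close> to \<open>t / c\<close>.\<close>

lemma sublinear_sublinear_shift:
  assumes q: "sublinear q"
  shows "sublinear (sublinear_shift q a)"
proof -
  let ?s = "sublinear_shift q a"
  have "?s (x + y) \<le> ?s x + ?s y" for x y
  proof -
    have "?s (x + y) - (q (x + t *\<^sub>R a) - t * q a) \<le> q (y + u *\<^sub>R a) - u * q a"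
      if "0 \<le> t" "0 \<le> u" for t u
    proof -
      have "?s (x + y) \<le> q ((x + y) + (t + u) *\<^sub>R a) - (t + u) * q a"
        using that by (intro sublinear_shift_le[OF q]) auto
      also have "(x + y) + (t + u) *\<^sub>R a = (x + t *\<^sub>R a) + (y + u *\<^sub>R a)"
        by (simp add: algebra_simps)
      also have "q \<dots> \<le> q (x + t *\<^sub>R a) + q (y + u *\<^sub>R a)" by (rule sublinear_add[OF q])
      finally show ?thesis by (simp add: algebra_simps)
    qed
    then have "?s (x + y) - (q (x + t *\<^sub>R a) - t * q a) \<le> ?s y" if "0 \<le> t" for t
      using that by (intro sublinear_shift_greatest) auto
    then have "?s (x + y) - ?s y \<le> ?s x"
      by (intro sublinear_shift_greatest) (simp add: algebra_simps)
    then show ?thesis by simp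
  qed
  moreover have le: "c * ?s x \<le> ?s (c *\<^sub>R x)" if c: "0 < c" for c x
  proof (rule sublinear_shift_greatest)
    fix t :: real assume t: "0 \<le> t"
    have "c * ?s x \<le> c * (q (x + (t / c) *\<^sub>R a) - (t / c) * q a)"
      using c t by (intro mult_left_mono sublinear_shift_le[OF q]) auto
    also have "\<dots> = q (c *\<^sub>R (x + (t / c) *\<^sub>R a)) - t * q a"
      using c by (simp add: sublinear_scale[OF q] right_diff_distrib)
    also have "c *\<^sub>R (x + (t / c) *\<^sub>R a) = c *\<^sub>R x + t *\<^sub>R a"
      using c by (simp add: scaleR_add_right)
    finally show "c * ?s x \<le> q (c *\<^sub>R x + t *\<^sub>R a) - t * q a" .
  qed
  \<comment> \<open>The reverse inequality is \<open>le\<close> with factor \<open>1 / c\<close> at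
    the scaled point.\<close>
  moreover have "?s (c *\<^sub>R x) \<le> c * ?s x" if c: "0 < c" for c x
    using le[of "1 / c" "c *\<^sub>R x"] c by (simp add: field_simps)
  ultimately show ?thesis unfolding sublinear_def by (metis order_antisym)
qed

lemma sublinear_shift_self: "sublinear q \<Longrightarrow> sublinear_shift q a x \<le> q x"
  using sublinear_shift_le[of q 0 a x] by simp

lemma sublinear_shift_minus: "sublinear q \<Longrightarrow> sublinear_shift q a (- a) \<le> - q a"
  using sublinear_shift_le[of q 1 a "- a"] by (simp add: sublinear_zero)

lemma minimal_sublinear_imp_linear:
  assumes r: "sublinear r" and min: "\<And>s. sublinear s \<Longrightarrow> s \<le> r \<Longrightarrow> s = r"
  shows "linear r"
proof -
  have shift: "sublinear_shift r a = r" for a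
    by (intro min sublinear_sublinear_shift r) (auto simp: le_fun_def sublinear_shift_self[OF r])
  \<comment> \<open>Since \<open>r\<close> is its own shift along \<open>y\<close>, the parameter 1
    gives \<open>r x <= r (x + y) - r y\<close>, the converse of subadditivity.\<close>
  have add: "r (x + y) = r x + r y" for x y
    using sublinear_shift_le[OF r, of 1 y x] sublinear_add[OF r, of x y] by (simp add: shift)
  have minus: "r (- x) = - r x" for x
    using add[of x "- x"] sublinear_zero[OF r] by simp
  have "r (c *\<^sub>R x) = c * r x" for c x
  proof (cases c "0::real" rule: linorder_cases)
    case less
    have "r (c *\<^sub>R x) = - r ((- c) *\<^sub>R x)" using minus[of "c *\<^sub>R x"] by simp
    then show ?thesis using less by (simp only: sublinear_scale[OF r])
  next
    case equal
    then show ?thesis by (simp add: sublinear_zero[OF r])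
  next
    case greater
    then show ?thesis by (rule sublinear_scale[OF r])
  qed
  then show ?thesis using add by (intro linearI) auto
qed

text \<open>Zorn's lemma on the sublinear minorants of \<open>q\<close>, ordered downwards: the
  pointwise infimum of a nonempty chain is again one, and a minimal minorant is linear.\<close>

lemma sublinear_dominates_linear:
  assumes q: "sublinear q"
  shows "\<exists>f. linear f \<and> f \<le> q"
proof -
  define A where "A = {s. sublinear s \<and> s \<le> q}"
  have "\<exists>m\<in>A. \<forall>a\<in>A. a \<le> m \<longrightarrow> a = m"
  proof (rule predicate_Zorn[of A "\<lambda>x y. y \<le> x"])
    show "partial_order_on A (relation_of (\<lambda>x y. y \<le> x) A)"
      by (intro partial_order_on_relation_ofI) auto
    fix C assume C: "C \<in> Chains (relation_of (\<lambda>x y. y \<le> x) A)"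
    show "\<exists>u\<in>A. \<forall>a\<in>C. u \<le> a"
    proof (cases "C = {}")
      case True
      then show ?thesis using q by (auto simp: A_def)
    next
      case False
      have CA: "C \<subseteq> A" and chain: "\<And>a b. a \<in> C \<Longrightarrow> b \<in> C \<Longrightarrow> a \<le> b \<or> b \<le> a"
        using C by (auto simp: Chains_def relation_of_def)
      have sub: "sublinear a" "a x \<le> q x" if "a \<in> C" for a x
        using that CA by (auto simp: A_def le_fun_def)
      have bdd: "bdd_below ((\<lambda>a. a x) ` C)" for x
      proof (rule bdd_belowI2)
        fix a assume a: "a \<in> C"
        show "- q (- x) \<le> a x" using sublinear_minus[OF sub(1)[OF a], of x] sub(2)[OF a, of "- x"] by simp
      qed
      define u where "u x = (INF a\<in>C. a x)" for x
      have u_le: "u x \<le> a x" if "a \<in> C" for a x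
        unfolding u_def using that bdd by (intro cINF_lower)
      have u_ge: "m \<le> u x" if "\<And>a. a \<in> C \<Longrightarrow> m \<le> a x" for m x
        unfolding u_def using that False by (intro cINF_greatest) auto
      have "u (x + y) \<le> u x + u y" for x y
      proof -
        have ab: "u (x + y) - a x \<le> b y" if "a \<in> C" "b \<in> C" for a b
        proof -
          \<comment> \<open>In a chain the smaller of the two functionals can serve for both
            \<open>x\<close> and \<open>y\<close>.\<close>
          have "\<exists>c\<in>C. c \<le> a \<and> c \<le> b" using chain[OF that] that by blast
          then obtain c where c: "c \<in> C" "c \<le> a" "c \<le> b" by blast
          have "u (x + y) \<le> c x + c y"
            using u_le[OF c(1), of "x + y"] sublinear_add[OF sub(1)[OF c(1)], of x y] by linarith
          then show ?thesis using le_funD[OF c(2), of x] le_funD[OF c(3), of y] by linarith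
        qed
        then have "u (x + y) - a x \<le> u y" if "a \<in> C" for a
          using that by (intro u_ge)
        then have "u (x + y) - u y \<le> u x"
          by (intro u_ge) (simp add: algebra_simps)
        then show ?thesis by simp
      qed
      moreover have le: "c * u x \<le> u (c *\<^sub>R x)" if c: "0 < c" for c x
      proof (rule u_ge)
        fix a assume a: "a \<in> C"
        show "c * u x \<le> a (c *\<^sub>R x)"
          using u_le[OF a, of x] c by (simp add: sublinear_scale[OF sub(1)[OF a]])
      qed
      moreover have "u (c *\<^sub>R x) \<le> c * u x" if c: "0 < c" for c x
        using le[of "1 / c" "c *\<^sub>R x"] c by (simp add: field_simps)
      ultimately have "sublinear u" unfolding sublinear_def by (metis order_antisym)
      moreover obtain a where "a \<in> C" using False by blast
      then have "u \<le> q" using u_le sub(2) by (meson le_funI order_trans)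
      ultimately show ?thesis using u_le by (auto simp: A_def le_fun_def)
    qed
  qed
  then obtain m where "sublinear m" "m \<le> q" "\<And>a. sublinear a \<Longrightarrow> a \<le> m \<Longrightarrow> a = m"
    unfolding A_def by (auto intro: order_trans)
  then show ?thesis using minimal_sublinear_imp_linear by blast
qed

text \<open>Near-minimisers in \<open>V\<close> may be added and scaled. The distance is the
  majorant wanted for Hahn--Banach: it vanishes on \<open>V\<close>, lies below the norm, and is
  positive off a closed \<open>V\<close>.\<close>

lemma sublinear_infdist_subspace:
  fixes V :: "'a::real_normed_vector set"
  assumes V: "subspace V"
  shows "sublinear (\<lambda>x. infdist x V)"
proof -
  have ne: "V \<noteq> {}" using V subspace_0 by blast
  have approx: "\<exists>v\<in>V. dist x v < infdist x V + e" if "e > 0" for x and e :: real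
    using that ne by (metis add_strict_increasing2 infdist_attains_inf less_add_same_cancel1 infdist_notempty cINF_less_iff bdd_below_image_dist)
  have "infdist (x + y) V \<le> infdist x V + infdist y V" for x y
  proof (rule field_le_epsilon)
    fix e :: real assume e: "e > 0"
    obtain v where v: "v \<in> V" "dist x v < infdist x V + e / 2" using approx[of "e/2" x] e by auto
    obtain w where w: "w \<in> V" "dist y w < infdist y V + e / 2" using approx[of "e/2" y] e by auto
    have "infdist (x + y) V \<le> dist (x + y) (v + w)"
      using V v w by (intro infdist_le) (auto intro: subspace_add)
    also have "\<dots> \<le> dist x v + dist y w" by (rule dist_triangle_add)
    finally show "infdist (x + y) V \<le> infdist x V + infdist y V + e" using v w by linarith
  qed
  moreover have le: "infdist (c *\<^sub>R x) V \<le> c * infdist x V" if c: "0 < c" for c x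
  proof (rule field_le_epsilon)
    fix e :: real assume e: "e > 0"
    obtain v where v: "v \<in> V" "dist x v < infdist x V + e / c" using approx[of "e/c" x] e c by auto
    have "infdist (c *\<^sub>R x) V \<le> dist (c *\<^sub>R x) (c *\<^sub>R v)"
      using V v by (intro infdist_le) (auto intro: subspace_scale)
    also have "\<dots> = c * dist x v" using c by (simp add: dist_norm flip: scaleR_diff_right)
    also have "\<dots> \<le> c * (infdist x V + e / c)" using v c by (intro mult_left_mono) auto
    finally show "infdist (c *\<^sub>R x) V \<le> c * infdist x V + e" using c by (simp add: distrib_left)
  qed
  moreover have "c * infdist x V \<le> infdist (c *\<^sub>R x) V" if c: "0 < c" for c x
    using le[of "1 / c" "c *\<^sub>R x"] c by (simp add: field_simps)
  ultimately show ?thesis unfolding sublinear_def by (metis order_antisym)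
qed

text \<open>Take a linear functional below the shift of the distance at \<open>p\<close>. Lying
  below the distance makes it continuous and zero on \<open>V\<close>; lying below the shift gives
  \<open>f (- p) <= - infdist p V < 0\<close>.\<close>

lemma closed_subspace_separation:
  fixes V :: "'a::real_normed_vector set"
  assumes V: "subspace V" "closed V" and p: "p \<notin> V"
  shows "\<exists>f :: 'a \<Rightarrow>\<^sub>L real. (\<forall>v\<in>V. blinfun_apply f v = 0) \<and> blinfun_apply f p \<noteq> 0"
proof -
  define q where "q x = infdist x V" for x
  have q: "sublinear q" unfolding q_def by (rule sublinear_infdist_subspace[OF V(1)])
  obtain f where f: "linear f" "f \<le> sublinear_shift q p"
    using sublinear_dominates_linear[OF sublinear_sublinear_shift[OF q]] by blast
  interpret f: linear f by fact
  have fq: "f x \<le> q x" for x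
    using le_funD[OF f(2), of x] sublinear_shift_self[OF q, of p x] by linarith
  have "q x \<le> norm x" for x
    unfolding q_def using infdist_le[OF subspace_0[OF V(1)], of x] by simp
  then have "norm (f x) \<le> norm x * 1" for x
    using fq[of x] fq[of "- x"] by (auto simp: f.neg abs_le_iff) (metis norm_minus_cancel order_trans)+
  then have bl: "bounded_linear f"
    using f(1) by (intro bounded_linear_intro[where K = 1]) (auto simp: f.add f.scaleR)
  have "q p > 0" unfolding q_def using V p subspace_0[OF V(1)]
    by (metis empty_iff in_closed_iff_infdist_zero infdist_nonneg less_eq_real_def)
  moreover have "f (- p) \<le> - q p"
    using le_funD[OF f(2), of "- p"] sublinear_shift_minus[OF q, of p] by linarith
  ultimately have "f p \<noteq> 0" by (simp add: f.neg)
  moreover have "f v = 0" if v: "v \<in> V" for v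
    using fq[of v] fq[of "- v"] v subspace_neg[OF V(1) v] by (simp add: q_def f.neg)
  ultimately show ?thesis
    by (intro exI[of _ "Blinfun f"]) (simp add: bounded_linear_Blinfun_apply[OF bl])
qed

lemma closed_affine_separation:
  fixes H :: "'a::real_normed_vector set"
  assumes H: "affine H" "closed H" "u \<in> H" and p: "p \<notin> H"
  shows "\<exists>f :: 'a \<Rightarrow>\<^sub>L real. (\<forall>v\<in>H. blinfun_apply f v = blinfun_apply f u) \<and> blinfun_apply f p \<noteq> blinfun_apply f u"
proof -
  let ?V = "(\<lambda>x. - u + x) ` H"
  have "- u + p \<notin> ?V" using p by auto
  then obtain f :: "'a \<Rightarrow>\<^sub>L real" where f: "\<And>v. v \<in> ?V \<Longrightarrow> f v = 0" "f (- u + p) \<noteq> 0"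
    using closed_subspace_separation[OF affine_diffs_subspace[OF H(1,3)] closed_translation[OF H(2)]]
    by blast
  show ?thesis
  proof (intro exI[of _ f] conjI ballI)
    show "f v = f u" if "v \<in> H" for v
      using f(1)[of "- u + v"] that by (simp add: blinfun.bilinear_simps)
    show "f p \<noteq> f u" using f(2) by (simp add: blinfun.bilinear_simps)
  qed
qed

subsection \<open>Intrinsic core and relative interior\<close>

text \<open>Both sides equal the translate of \<open>affine hull D\<close> by minus a point of
  \<open>D\<close>, a linear subspace. This ties the directions in \<open>icr\<close> to the affine
  hull of \<open>D\<close> itself.\<close>

lemma affine_hull_mdiff_self:
  assumes "D \<noteq> {}"
  shows "affine hull (mdiff D D) = {x - y | x y. x \<in> affine hull D \<and> y \<in> affine hull D}"
    (is "?L = ?R")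
proof
  obtain d where d: "d \<in> D" using assms by blast
  let ?V = "(\<lambda>x. - d + x) ` (affine hull D)"
  have V: "subspace ?V"
    by (rule affine_diffs_subspace) (use d in \<open>auto simp: hull_inc\<close>)
  have RV: "?R \<subseteq> ?V"
  proof clarify
    fix x y assume "x \<in> affine hull D" "y \<in> affine hull D"
    then have "(- d + x) - (- d + y) \<in> ?V" using V by (intro subspace_diff) auto
    then show "x - y \<in> ?V" by simp
  qed
  have "mdiff D D \<subseteq> ?R" unfolding mdiff_def by (auto intro: hull_inc)
  then have "?L \<subseteq> ?V" using RV V by (intro hull_minimal) (auto intro: subspace_imp_affine)
  also have "?V \<subseteq> ?R" using d by (force intro: hull_inc)
  finally show "?L \<subseteq> ?R" .
  have "?V = affine hull ((\<lambda>x. - d + x) ` D)" by (simp only: affine_hull_translation)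
  also have "\<dots> \<subseteq> ?L"
    by (intro hull_mono) (use d in \<open>force simp: mdiff_def\<close>)
  finally have VL: "?V \<subseteq> ?L" .
  show "?R \<subseteq> ?L" using RV VL by blast
qed

text \<open>Since 0 is a direction, core points lie in \<open>D\<close>; the directions are then the
  vectors \<open>x - u\<close> with \<open>x\<close> in \<open>affine hull D\<close>.\<close>

lemma mem_icr_iff:
  assumes "D \<noteq> {}"
  shows "u \<in> icr D \<longleftrightarrow> u \<in> D \<and> (\<forall>x \<in> affine hull D. \<exists>\<delta>>0. \<forall>t\<in>{0..\<delta>}. u + t *\<^sub>R (x - u) \<in> D)"
proof (intro iffI conjI ballI)
  assume u: "u \<in> icr D"
  have "0 \<in> affine hull (mdiff D D)"
    using assms unfolding mdiff_def by (intro hull_inc) force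
  with u obtain \<delta> where "\<delta> > 0" "\<forall>t\<in>{0..\<delta>}. u + t *\<^sub>R 0 \<in> D" unfolding icr_def by blast
  then show uD: "u \<in> D" by force
  fix x assume "x \<in> affine hull D"
  then have "x - u \<in> affine hull (mdiff D D)"
    using affine_hull_mdiff_self[OF assms] uD hull_inc[of u D] by blast
  with u show "\<exists>\<delta>>0. \<forall>t\<in>{0..\<delta>}. u + t *\<^sub>R (x - u) \<in> D" unfolding icr_def by blast
next
  assume u: "u \<in> D \<and> (\<forall>x \<in> affine hull D. \<exists>\<delta>>0. \<forall>t\<in>{0..\<delta>}. u + t *\<^sub>R (x - u) \<in> D)"
  have "\<exists>\<delta>>0. \<forall>t\<in>{0..\<delta>}. u + t *\<^sub>R z \<in> D" if z: "z \<in> affine hull (mdiff D D)" for z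
  proof -
    obtain x y where xy: "z = x - y" "x \<in> affine hull D" "y \<in> affine hull D"
      using z unfolding affine_hull_mdiff_self[OF assms] by blast
    have "1 *\<^sub>R u + 1 *\<^sub>R x + (-1) *\<^sub>R y \<in> affine hull D"
      using xy u by (intro mem_affine_3) (auto intro: hull_inc)
    then have "u + z \<in> affine hull D" by (simp add: xy add_diff_eq)
    with u have "\<exists>\<delta>>0. \<forall>t\<in>{0..\<delta>}. u + t *\<^sub>R (u + z - u) \<in> D" by blast
    then show ?thesis by simp
  qed
  then show "u \<in> icr D" unfolding icr_def by blast
qed

text \<open>Equal affine hulls give the same closedness test and the same directions, so only the
  set that must contain the short segments grows.\<close>

lemma ic_mono:
  assumes "D \<noteq> {}" "D \<subseteq> E" "affine hull D = affine hull E"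
  shows "ic D \<subseteq> ic E"
proof -
  have "E \<noteq> {}" using assms by blast
  then have "icr D \<subseteq> icr E"
    using assms(2,3) unfolding subset_iff mem_icr_iff[OF assms(1)] mem_icr_iff[OF \<open>E \<noteq> {}\<close>] by metis
  then show ?thesis using assms by (simp add: ic_def)
qed

lemma rel_interior_subset_icr:
  fixes D :: "'a::real_normed_vector set"
  shows "rel_interior D \<subseteq> icr D"
proof
  fix u assume "u \<in> rel_interior D"
  then obtain e where uD: "u \<in> D" and e: "e > 0" "ball u e \<inter> affine hull D \<subseteq> D"
    by (auto simp: mem_rel_interior_ball)
  have "\<exists>\<delta>>0. \<forall>t\<in>{0..\<delta>}. u + t *\<^sub>R (x - u) \<in> D" if x: "x \<in> affine hull D" for x
  proof (intro exI conjI ballI)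
    define \<delta> where "\<delta> = e / (norm (x - u) + 1)"
    have pos: "norm (x - u) + 1 > 0" by (rule add_nonneg_pos) auto
    then show "\<delta> > 0" using e by (simp add: \<delta>_def)
    fix t assume t: "t \<in> {0..\<delta>}"
    have "t * norm (x - u) \<le> \<delta> * norm (x - u)"
      using t by (intro mult_right_mono) auto
    also have "\<dots> < \<delta> * (norm (x - u) + 1)" using \<open>\<delta> > 0\<close> by simp
    also have "\<dots> = e" using pos by (simp add: \<delta>_def)
    finally have "u + t *\<^sub>R (x - u) \<in> ball u e" using t by (simp add: dist_norm)
    moreover have "(1 - t) *\<^sub>R u + t *\<^sub>R x \<in> affine hull D"
      using x uD by (intro mem_affine) (auto intro: hull_inc)
    ultimately show "u + t *\<^sub>R (x - u) \<in> D" using e(2) by (auto simp: algebra_simps)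
  qed
  then show "u \<in> icr D" using uD mem_icr_iff[of D u] by blast
qed

text \<open>Extend the segment from \<open>w\<close> through \<open>u\<close> slightly beyond
  \<open>u\<close>, still inside \<open>D\<close>. Then \<open>u\<close> is a proper convex
  combination of the new endpoint and \<open>w\<close>, and the ball around \<open>w\<close> shrinks
  to one around \<open>u\<close>.\<close>

lemma convex_core_relative_interior:
  fixes D :: "'a::real_normed_vector set"
  assumes "convex D" and u: "u \<in> icr D"
    and w: "w \<in> D" "r > 0" "ball w r \<inter> affine hull D \<subseteq> D"
  shows "u \<in> rel_interior D"
proof -
  have ne: "D \<noteq> {}" using w by blast
  let ?H = "affine hull D"
  have uD: "u \<in> D" using u ne by (simp add: mem_icr_iff)
  have uH: "u \<in> ?H" "w \<in> ?H" using uD w by (auto intro: hull_inc)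
  have "1 *\<^sub>R u + 1 *\<^sub>R u + (-1) *\<^sub>R w \<in> ?H"
    using uH by (intro mem_affine_3) auto
  then have "u + (u - w) \<in> ?H" by (simp add: algebra_simps)
  then obtain t where t: "t > 0" "u + t *\<^sub>R (u + (u - w) - u) \<in> D"
    using u unfolding mem_icr_iff[OF ne] by (meson atLeastAtMost_iff less_imp_le order_refl)
  \<comment> \<open>The weight for which \<open>u\<close> is \<open>1 - s\<close> times the endpoint
    \<open>u + t (u - w)\<close> plus \<open>s\<close> times \<open>w\<close>.\<close>
  define s where "s = t / (1 + t)"
  have s: "0 < s" "s < 1" "(1 - s) * t = s" using t by (auto simp: s_def field_simps)
  have "ball u (s * r) \<inter> ?H \<subseteq> D"
  proof clarify
    fix z assume z: "z \<in> ball u (s * r)" "z \<in> ?H"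
    define z' where "z' = w + (1 / s) *\<^sub>R (z - u)"
    have "1 *\<^sub>R w + (1/s) *\<^sub>R z + (-1/s) *\<^sub>R u \<in> ?H"
      using uH z by (intro mem_affine_3) auto
    then have "z' \<in> ?H" by (simp add: z'_def algebra_simps)
    moreover have "norm (z - u) < s * r" using z by (simp add: dist_norm norm_minus_commute)
    then have "norm ((1 / s) *\<^sub>R (z - u)) < r" using s by (simp only: norm_scaleR) (simp add: field_simps)
    then have "z' \<in> ball w r" by (simp add: z'_def dist_norm norm_minus_commute)
    ultimately have z'D: "z' \<in> D" using w by blast
    have "(1 - s) *\<^sub>R (u + t *\<^sub>R (u - w)) + s *\<^sub>R z' \<in> D"
      using t z'D s \<open>convex D\<close> by (intro convexD) auto
    moreover have "(1 - s) *\<^sub>R (u + t *\<^sub>R (u - w)) + s *\<^sub>R z' = z"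
    proof -
      have "(1 - s) *\<^sub>R (u + t *\<^sub>R (u - w)) + s *\<^sub>R z'
        = (1 - s) *\<^sub>R u + ((1 - s) * t) *\<^sub>R (u - w) + (s *\<^sub>R w + (z - u))"
        using s by (simp add: z'_def scaleR_add_right)
      also have "\<dots> = z" unfolding s(3) by (simp add: algebra_simps)
      finally show ?thesis .
    qed
    ultimately show "z \<in> D" by simp
  qed
  then show ?thesis using s w uD by (auto simp: mem_rel_interior_ball intro!: exI[of _ "s * r"])
qed

text \<open>Successive approximation as in the open mapping theorem: pick \<open>p\<close> in
  \<open>K\<close> with \<open>L p\<close> near \<open>g\<close> and continue with
  \<open>2 g - L p\<close>. Unrolled, \<open>g0\<close> is the sum of the \<open>L (p i)\<close>
  with weights 1/2, 1/4, ...; the same series of the \<open>p i\<close> converges to a point of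
  \<open>K\<close> by completeness and convexity.\<close>

lemma ball_closure_image_subset_image:
  fixes L :: "'p::banach \<Rightarrow> 'e::real_normed_vector"
  assumes L: "bounded_linear L"
    and K: "closed K" "convex K" "bounded K"
    and H: "affine H" "L ` K \<subseteq> H"
    and r: "r > 0" "ball w r \<inter> H \<subseteq> closure (L ` K)"
  shows "ball w (r/2) \<inter> H \<subseteq> L ` K"
proof
  fix g0 assume g0: "g0 \<in> ball w (r/2) \<inter> H"
  interpret L: bounded_linear L by fact
  \<comment> \<open>The radii grow from \<open>r / 2\<close> towards \<open>r\<close>, so all
    iterates stay where the closure hypothesis applies; consecutive radii differ by
    \<open>r / 2 ^ (n + 2)\<close>, the approximation error allowed in \<open>step\<close>.\<close>
  define good where "good n g \<longleftrightarrow> g \<in> H \<and> dist w g < r * (1 - (1/2) ^ Suc n)" for n g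
  have lt: "dist w g < r" if "good n g" for n g
  proof -
    have "r * (1 - (1/2) ^ Suc n) < r * 1" using r(1) by (intro mult_strict_left_mono) auto
    then show ?thesis using that by (simp add: good_def)
  qed
  have step: "\<exists>p\<in>K. good (Suc n) (2 *\<^sub>R g - L p)" if g: "good n g" for n g
  proof -
    have "g \<in> closure (L ` K)" using g r lt[OF g] by (auto simp: good_def)
    then obtain p where p: "p \<in> K" "dist (L p) g < r * (1/2) ^ Suc (Suc n)"
      unfolding closure_approachable using r(1) by (auto dest!: spec[of _ "r * (1/2) ^ Suc (Suc n)"])
    have "2 *\<^sub>R g + (-1) *\<^sub>R L p \<in> H" using H p g by (intro mem_affine) (auto simp: good_def)
    moreover have "dist w (2 *\<^sub>R g - L p) \<le> dist w g + dist (L p) g"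
    proof -
      have "w - (2 *\<^sub>R g - L p) = (w - g) + (L p - g)" by (simp add: scaleR_2)
      then show ?thesis unfolding dist_norm by (metis norm_triangle_ineq)
    qed
    then have "dist w (2 *\<^sub>R g - L p) < r * (1 - (1/2) ^ Suc n) + r * (1/2) ^ Suc (Suc n)"
      using g p by (simp add: good_def)
    then have "dist w (2 *\<^sub>R g - L p) < r * (1 - (1/2) ^ Suc (Suc n))" by (simp add: algebra_simps)
    ultimately show ?thesis using p by (auto simp: good_def)
  qed
  have "good 0 g0" using g0 by (simp add: good_def)
  have "\<exists>g. \<forall>n. (good n (g n) \<and> (n = 0 \<longrightarrow> g n = g0)) \<and> (\<exists>p\<in>K. g (Suc n) = 2 *\<^sub>R g n - L p)"
    by (rule dependent_nat_choice) (use \<open>good 0 g0\<close> step in blast)+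
  then obtain g where g: "g 0 = g0" "\<And>n. good n (g n)"
    and gp: "\<And>n. \<exists>p\<in>K. g (Suc n) = 2 *\<^sub>R g n - L p"
    by blast
  from gp obtain p where p: "\<And>n. p n \<in> K" "\<And>n. g (Suc n) = 2 *\<^sub>R g n - L (p n)"
    by metis
  define s where "s n = (\<Sum>i<n. (1/2) ^ Suc i *\<^sub>R p i)" for n
  obtain B where B: "\<And>x. x \<in> K \<Longrightarrow> norm x \<le> B" using K(3) by (auto simp: bounded_iff)
  have "summable (\<lambda>i. (1/2) ^ Suc i *\<^sub>R p i)"
  proof (rule summable_comparison_test')
    show "summable (\<lambda>i. B * (1/2::real) ^ Suc i)"
      by (intro summable_mult) (simp add: summable_geometric)
    show "norm ((1/2) ^ Suc n *\<^sub>R p n) \<le> B * (1/2) ^ Suc n" if "n \<ge> 0" for n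
      using B[OF p(1)[of n]] by (simp add: mult.commute)
  qed
  then obtain q where q: "s \<longlonglongrightarrow> q"
    unfolding s_def by (auto simp: summable_def sums_def)
  \<comment> \<open>The weights in \<open>s n\<close> sum to \<open>1 - 1 / 2 ^ n\<close>, so
    putting the missing weight on a point of \<open>K\<close> gives a convex combination. The
    induction absorbs \<open>p n\<close> into that last point.\<close>
  have tail: "s n + (1/2)^n *\<^sub>R a \<in> K" if "a \<in> K" for n a
    using that
  proof (induction n arbitrary: a)
    case 0 then show ?case by (simp add: s_def)
  next
    case (Suc n)
    have "(1/2) *\<^sub>R p n + (1/2) *\<^sub>R a \<in> K" using K(2) p Suc.prems by (intro convexD) auto
    from Suc.IH[OF this] show ?case by (simp add: s_def scaleR_add_right add.assoc)
  qed
  have half: "(\<lambda>n. (1/2)^n :: real) \<longlonglongrightarrow> 0" by (intro LIMSEQ_realpow_zero) auto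
  have "(\<lambda>n. s n + (1/2)^n *\<^sub>R p 0) \<longlonglongrightarrow> q + 0 *\<^sub>R p 0"
    by (intro tendsto_intros q half)
  then have qK: "q \<in> K" using K(1) tail p(1) closed_sequentially[of K "\<lambda>n. s n + (1/2)^n *\<^sub>R p 0" q] by auto
  have Ls: "L (s n) = g0 - (1/2)^n *\<^sub>R g n" for n
  proof (induction n)
    case 0 then show ?case by (simp add: s_def g)
  next
    case (Suc n)
    have "L (s (Suc n)) = L (s n) + (1/2) ^ Suc n *\<^sub>R L (p n)"
      by (simp add: s_def L.add L.scaleR)
    then show ?case unfolding p(2) Suc by (simp add: algebra_simps)
  qed
  have bg: "norm (g n) \<le> norm w + r" for n
  proof -
    have "norm (g n) \<le> norm w + norm (g n - w)" by (rule norm_triangle_sub)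
    then show ?thesis using lt[OF g(2)[of n]] by (simp add: dist_norm norm_minus_commute)
  qed
  have "(\<lambda>n. (1/2)^n *\<^sub>R g n) \<longlonglongrightarrow> 0"
  proof (rule Lim_null_comparison)
    show "\<forall>\<^sub>F n in sequentially. norm ((1/2)^n *\<^sub>R g n) \<le> (1/2)^n * (norm w + r)"
      using bg by (auto intro!: always_eventually mult_left_mono)
    show "(\<lambda>n. (1/2)^n * (norm w + r)) \<longlonglongrightarrow> 0" using tendsto_mult_left_zero[OF half] by simp
  qed
  then have "(\<lambda>n. g0 - (1/2)^n *\<^sub>R g n) \<longlonglongrightarrow> g0 - 0" by (intro tendsto_intros)
  moreover have "(\<lambda>n. L (s n)) \<longlonglongrightarrow> L q" using q by (rule L.tendsto)
  ultimately have "L q = g0" unfolding Ls using LIMSEQ_unique by fastforce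
  then show "g0 \<in> L ` K" using qK by blast
qed

text \<open>Robinson--Ursescu argument: by Baire, some dilate of the closure of one of the images of
  bounded pieces has relative interior; such images are ideally convex, so the closure is superfluous.\<close>
lemma icr_subset_rel_interior_image:
  fixes L :: "'p::banach \<Rightarrow> 'e::banach"
  assumes L: "bounded_linear L"
    and C: "\<And>k::nat. closed (C k)" "\<And>k. convex (C k)" "incseq C"
    and D: "D = L ` (\<Union>k. C k)"
    and ne: "D \<noteq> {}" and cl: "closed (affine hull D)" and u: "u \<in> icr D"
  shows "u \<in> rel_interior D"
proof -
  interpret L: bounded_linear L by fact
  let ?H = "affine hull D"
  \<comment> \<open>Truncation by balls supplies the boundedness that the preceding lemma demands,
    without changing the union.\<close>
  define K where "K k = C k \<inter> cball 0 (real k)" for k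
  have K: "closed (K k)" "convex (K k)" "bounded (K k)" for k
    using C by (auto simp: K_def closed_Int convex_Int bounded_Int)
  have incK: "K i \<subseteq> K j" if "i \<le> j" for i j
    using C(3) that by (force simp: K_def incseq_def)
  have UK: "D = (\<Union>k. L ` K k)"
  proof -
    have "\<exists>j. p \<in> K j" if "p \<in> C k" for p k
    proof -
      obtain m::nat where "norm p \<le> m" using real_arch_simple by blast
      then have "p \<in> K (max k m)" using that C(3) by (auto simp: K_def incseq_def) (meson max.cobounded1 subsetD)
      then show ?thesis by blast
    qed
    then have "(\<Union>k. C k) = (\<Union>k. K k)" by (auto simp: K_def)
    then show ?thesis by (auto simp: D)
  qed
  have LKD: "L ` K k \<subseteq> ?H" for k using UK hull_subset[of D affine] by blast
  have "convex (\<Union>k. C k)"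
  proof (rule convexI)
    fix x y and a b :: real assume ab: "x \<in> (\<Union>k. C k)" "y \<in> (\<Union>k. C k)" "0 \<le> a" "0 \<le> b" "a + b = 1"
    then obtain i j where "x \<in> C i" "y \<in> C j" by blast
    then have "x \<in> C (max i j)" "y \<in> C (max i j)" using C(3) unfolding incseq_def by (meson max.cobounded1 max.cobounded2 subsetD)+
    then show "a *\<^sub>R x + b *\<^sub>R y \<in> (\<Union>k. C k)" using C(2)[of "max i j"] ab by (auto intro: convexD)
  qed
  then have cD: "convex D" unfolding D by (rule convex_linear_image[OF L.linear])
  have uD: "u \<in> D" using u ne by (simp add: mem_icr_iff)
  \<comment> \<open>\<open>F (n, k)\<close> collects the points whose contraction towards
    \<open>u\<close> with ratio \<open>1 / Suc n\<close> falls into the closure of the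
    \<open>k\<close>-th image. As \<open>u\<close> is in the intrinsic core, these countably many
    closed sets cover \<open>affine hull D\<close>.\<close>
  define F where "F = (\<lambda>(n::nat, k). {x \<in> ?H. u + (1 / Suc n) *\<^sub>R (x - u) \<in> closure (L ` K k)})"
  have clF: "closed (F z)" for z
  proof -
    have "closed ((\<lambda>x. u + (1 / Suc (fst z)) *\<^sub>R (x - u)) -` closure (L ` K (snd z)))"
      by (intro closed_vimage continuous_intros closed_closure)
    moreover have "F z = ?H \<inter> (\<lambda>x. u + (1 / Suc (fst z)) *\<^sub>R (x - u)) -` closure (L ` K (snd z))"
      by (auto simp: F_def split: prod.splits)
    ultimately show ?thesis using cl by (auto intro: closed_Int)
  qed
  have UF: "\<Union>(range F) = ?H"
  proof
    show "\<Union>(range F) \<subseteq> ?H" by (auto simp: F_def)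
    show "?H \<subseteq> \<Union>(range F)"
    proof
      fix x assume x: "x \<in> ?H"
      then obtain \<delta> where \<delta>: "\<delta> > 0" "\<And>t. t \<in> {0..\<delta>} \<Longrightarrow> u + t *\<^sub>R (x - u) \<in> D"
        using u ne by (meson mem_icr_iff)
      obtain n where "1 / Suc n < \<delta>" using \<delta>(1) nat_approx_posE by blast
      then have "u + (1 / Suc n) *\<^sub>R (x - u) \<in> D" by (intro \<delta>) auto
      then obtain k where "u + (1 / Suc n) *\<^sub>R (x - u) \<in> L ` K k" using UK by blast
      then have "x \<in> F (n, k)" using x closure_subset[of "L ` K k"] by (auto simp: F_def)
      then show "x \<in> \<Union>(range F)" by blast
    qed
  qed
  have "\<exists>z. top_of_set ?H interior_of (F z) \<noteq> {}"
  proof (rule ccontr)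
    assume "\<not> ?thesis"
    moreover have "completely_metrizable_space (top_of_set ?H)"
      by (intro completely_metrizable_space_closedin completely_metrizable_space_euclidean) (simp add: cl)
    moreover have "closedin (top_of_set ?H) (F z)" for z
      using clF[of z] by (intro closed_subset) (auto simp: F_def)
    ultimately have "top_of_set ?H interior_of (\<Union>(range F)) = {}"
      by (intro Baire_category_alt) auto
    then have "?H = {}" unfolding UF by (simp add: interior_of_topspace[of "top_of_set ?H", simplified])
    then show False using ne by simp
  qed
  then obtain n k x U where "x \<in> U" "openin (top_of_set ?H) U" "U \<subseteq> F (n, k)"
    by (auto simp: interior_of_def)
  then obtain e where xH: "x \<in> ?H" and e: "e > 0" "ball x e \<inter> ?H \<subseteq> F (n, k)"
    unfolding openin_contains_ball by (meson order_trans subsetD)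
  define c where "c = 1 / real (Suc n)"
  have c: "c > 0" by (simp add: c_def)
  \<comment> \<open>The contraction towards \<open>u\<close> carries the ball around
    \<open>x\<close> in the affine hull to the ball around \<open>w\<close> of radius
    \<open>c * e\<close>.\<close>
  define w where "w = u + c *\<^sub>R (x - u)"
  have uH: "u \<in> ?H" using uD by (rule hull_inc)
  have "ball w (c * e) \<inter> ?H \<subseteq> closure (L ` K k)"
  proof clarify
    fix z assume z: "z \<in> ball w (c * e)" "z \<in> ?H"
    define y where "y = u + (1/c) *\<^sub>R (z - u)"
    have "(1 - 1/c) *\<^sub>R u + (1/c) *\<^sub>R z \<in> ?H" using uH z by (intro mem_affine) auto
    then have "y \<in> ?H" by (simp add: y_def algebra_simps)
    moreover have "y \<in> ball x e"
    proof -
      have "x - y = (1/c) *\<^sub>R (w - z)" using c by (simp add: y_def w_def algebra_simps)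
      then have "dist x y = (1/c) * dist w z" unfolding dist_norm using c by simp
      also have "\<dots> < (1/c) * (c * e)" using z c by (intro mult_strict_left_mono) auto
      finally show ?thesis using c by simp
    qed
    ultimately have "y \<in> F (n, k)" using e by blast
    moreover have "u + c *\<^sub>R (y - u) = z" using c by (simp add: y_def)
    ultimately show "z \<in> closure (L ` K k)" by (simp add: F_def c_def)
  qed
  then have sub: "ball w (c * e / 2) \<inter> ?H \<subseteq> L ` K k"
    using c e by (intro ball_closure_image_subset_image[OF L K]) (auto simp: LKD)
  have "(1 - c) *\<^sub>R u + c *\<^sub>R x \<in> ?H" using uH xH by (intro mem_affine) auto
  then have "w \<in> ?H" by (simp add: w_def algebra_simps)
  then have "w \<in> L ` K k" using sub c e by auto
  then show ?thesis using sub c e UK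
    by (intro convex_core_relative_interior[OF cD u, of w "c * e / 2"]) auto
qed

subsection \<open>Representative functions and type (D)\<close>

lemma maximal_monotone_nonempty:
  assumes "maximal_monotone G"
  shows "G \<noteq> {}"
proof
  assume "G = {}"
  moreover have "monotone_op {(0, 0)}" by (auto simp: monotone_op_def)
  ultimately show False using assms unfolding maximal_monotone_def by blast
qed

text \<open>On the segment from \<open>(a, as)\<close> to \<open>(y, ys)\<close> convexity bounds
  \<open>h\<close> above and the coupling bounds it below, with equality at \<open>(a, as)\<close>.
  Dividing by the parameter \<open>s\<close> and letting it tend to 0 leaves the term of the
  Fitzpatrick function belonging to \<open>(a, as)\<close>.\<close>

lemma representative_ge_fitzpatrick:
  assumes rep: "representative G h" and p: "(a, as) \<in> G"
  shows "ereal (blinfun_apply as y + blinfun_apply ys a - blinfun_apply as a) \<le> h (y, ys)"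
proof -
  have ge: "ereal (coupling q) \<le> h q" for q using rep unfolding representative_def by blast
  have eq: "h (a, as) = ereal (as a)" using rep p by (auto simp: representative_def coupling_def)
  have conv: "convex {(p, r::real). h p \<le> ereal r}"
    using rep by (auto simp: representative_def ereal_convex_def)
  show ?thesis
  proof (cases "h (y, ys)")
    case (real r)
    define B where "B = as y + ys a - as a"
    have ineq: "(1 - s) * B + s * ys y \<le> r" if s: "s \<in> {0<..<1}" for s
    proof -
      have "(1 - s) *\<^sub>R ((a, as), as a) + s *\<^sub>R ((y, ys), r) \<in> {(p, r::real). h p \<le> ereal r}"
        using s eq real by (intro convexD[OF conv]) auto
      then have "h ((1 - s) *\<^sub>R a + s *\<^sub>R y, (1 - s) *\<^sub>R as + s *\<^sub>R ys) \<le> ereal ((1 - s) * as a + s * r)"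
        by simp
      with ge have "ereal (coupling ((1 - s) *\<^sub>R a + s *\<^sub>R y, (1 - s) *\<^sub>R as + s *\<^sub>R ys))
          \<le> ereal ((1 - s) * as a + s * r)"
        by (rule order_trans)
      then have "s * ((1 - s) * B + s * ys y) \<le> s * r"
        by (simp add: coupling_def blinfun.bilinear_simps B_def algebra_simps)
      then show ?thesis using s by simp
    qed
    have "((\<lambda>s. (1 - s) * B + s * ys y) \<longlongrightarrow> (1 - 0) * B + 0 * ys y) (at_right 0)"
      by (intro tendsto_intros)
    then have "(1 - 0) * B + 0 * ys y \<le> r"
      by (rule tendsto_upperbound)
        (use ineq eventually_at_right_real[of 0 1] in \<open>auto elim: eventually_mono\<close>)
    then show ?thesis using real by (simp add: B_def)
  qed (use ge[of "(y, ys)"] in auto)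
qed

text \<open>The Fitzpatrick lower bound along the isotropic line is affine, not quadratic, in the parameter;
  being bounded by a finite \<open>h (y, ys)\<close>, it must be constant.\<close>
lemma isotropic_constant_on_edom:
  fixes bs :: "'a::real_normed_vector dual" and b2 :: "'a bidual"
  assumes D: "gossez_D G" and rep: "representative G h"
    and iso: "blinfun_apply b2 bs = 0"
    and const: "\<And>a as. (a, as) \<in> G \<Longrightarrow> blinfun_apply bs a + blinfun_apply b2 as = \<alpha>"
    and y: "(y, ys) \<in> edom h"
  shows "blinfun_apply bs y + blinfun_apply b2 ys = \<alpha>"
proof -
  have max: "maximal_monotone G" using D by (simp add: gossez_D_def)
  then have mono: "monotone_op G" by (simp add: maximal_monotone_def)
  obtain a as where a: "(a, as) \<in> G" using maximal_monotone_nonempty[OF max] by auto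
  obtain r where r: "h (y, ys) \<le> ereal r"
    using y by (cases "h (y, ys)") (auto simp: edom_def)
  \<comment> \<open>The canonical image of \<open>a\<close> in the bidual.\<close>
  define ev :: "'a bidual" where "ev = Blinfun (\<lambda>f. blinfun_apply f a)"
  have ev: "ev f = f a" for f
    unfolding ev_def by (subst bounded_linear_Blinfun_apply) (rule blinfun.bounded_linear_left, rule refl)
  define c where "c = as y + ys a - as a"
  define d where "d = bs y + b2 ys - \<alpha>"
  have bound: "c + t * d \<le> r" for t
  proof -
    \<comment> \<open>The translate of \<open>(a, as)\<close> by \<open>t\<close> times
      \<open>(b2, bs)\<close>. It lies in the Gossez closure: the term linear in \<open>t\<close>
      cancels by \<open>const\<close>, the quadratic one by \<open>iso\<close>.\<close>
    define x2 where "x2 = ev + t *\<^sub>R b2"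
    define xs where "xs = as + t *\<^sub>R bs"
    have "0 \<le> x2 (xs - vs) - (xs - vs) v" if v: "(v, vs) \<in> G" for v vs
    proof -
      have "0 \<le> (as - vs) (a - v)" using mono a v by (auto simp: monotone_op_def)
      also have "(as - vs) (a - v) = x2 (xs - vs) - (xs - vs) v
          - t * ((bs a + b2 as) - (bs v + b2 vs)) - t * t * b2 bs"
        by (simp add: x2_def xs_def ev blinfun.bilinear_simps algebra_simps)
      also have "\<dots> = x2 (xs - vs) - (xs - vs) v" using const[OF a] const[OF v] iso by simp
      finally show ?thesis .
    qed
    then have "(x2, xs) \<in> gossez_closure G" by (auto simp: gossez_closure_def)
    then obtain F M where F: "F \<noteq> bot"
      and evG: "eventually (\<lambda>p. p \<in> G \<and> norm (fst p) \<le> M \<and> norm (snd p) \<le> M) F"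
      and lim1: "\<And>f. ((\<lambda>p. blinfun_apply f (fst p)) \<longlongrightarrow> x2 f) F"
      and lim2: "((\<lambda>p. snd p) \<longlongrightarrow> xs) F"
      using D unfolding gossez_D_def by blast
    \<comment> \<open>Bounded first components and norm convergence of the second ones let the
      pairing pass to the limit, which weak-star convergence alone would not.\<close>
    have null: "((\<lambda>p. norm (snd p - xs) * M) \<longlongrightarrow> 0) F"
      using lim2 by (intro tendsto_mult_left_zero tendsto_norm_zero) (simp add: LIM_zero)
    have "((\<lambda>p. blinfun_apply (snd p - xs) (fst p)) \<longlongrightarrow> 0) F"
    proof (rule Lim_null_comparison[OF _ null])
      show "\<forall>\<^sub>F p in F. norm (blinfun_apply (snd p - xs) (fst p)) \<le> norm (snd p - xs) * M"
        using evG
      proof eventually_elim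
        case (elim p)
        have "norm (blinfun_apply (snd p - xs) (fst p)) \<le> norm (snd p - xs) * norm (fst p)"
          by (rule norm_blinfun)
        also have "\<dots> \<le> norm (snd p - xs) * M" using elim by (intro mult_left_mono) auto
        finally show ?case .
      qed
    qed
    from tendsto_add[OF this lim1[of xs]]
    have lim3: "((\<lambda>p. blinfun_apply (snd p) (fst p)) \<longlongrightarrow> x2 xs) F"
      by (simp add: blinfun.diff_left)
    have lim4: "((\<lambda>p. blinfun_apply (snd p) y) \<longlongrightarrow> xs y) F"
      by (intro blinfun.tendsto lim2 tendsto_const)
    have "((\<lambda>p. blinfun_apply (snd p) y + ys (fst p) - blinfun_apply (snd p) (fst p))
        \<longlongrightarrow> xs y + x2 ys - x2 xs) F"
      by (intro tendsto_intros lim1 lim3 lim4)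
    moreover have "\<forall>\<^sub>F p in F. blinfun_apply (snd p) y + ys (fst p) - blinfun_apply (snd p) (fst p) \<le> r"
      using evG
    proof eventually_elim
      case (elim p)
      then have "ereal (blinfun_apply (snd p) y + ys (fst p) - blinfun_apply (snd p) (fst p)) \<le> h (y, ys)"
        by (intro representative_ge_fitzpatrick[OF rep]) auto
      with r have "ereal (blinfun_apply (snd p) y + ys (fst p) - blinfun_apply (snd p) (fst p)) \<le> ereal r"
        by (rule order_trans[rotated])
      then show ?case by simp
    qed
    ultimately have "xs y + x2 ys - x2 xs \<le> r" using F by (intro tendsto_upperbound)
    moreover have "xs y + x2 ys - x2 xs = c + t * (bs y + b2 ys - (bs a + b2 as)) - t * t * b2 bs"
      by (simp add: x2_def xs_def ev c_def blinfun.bilinear_simps algebra_simps)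
    ultimately show ?thesis using const[OF a] iso by (simp add: d_def)
  qed
  have "d = 0"
  proof (rule ccontr)
    assume "d \<noteq> 0"
    \<comment> \<open>At this parameter the bound would read \<open>r + 1 <= r\<close>.\<close>
    then show False using bound[of "(r - c + 1) / d"] by simp
  qed
  then show ?thesis by (simp add: d_def)
qed

subsection \<open>The difference sets\<close>

lemma convex_sublevel:
  assumes "ereal_convex h"
  shows "convex {p. h p \<le> ereal r}"
proof (rule convexI)
  fix x y and u v :: real
  assume "x \<in> {p. h p \<le> ereal r}" "y \<in> {p. h p \<le> ereal r}" "0 \<le> u" "0 \<le> v" and uv: "u + v = 1"
  then have "u *\<^sub>R (x, r) + v *\<^sub>R (y, r) \<in> {(p, r::real). h p \<le> ereal r}"
    using assms unfolding ereal_convex_def by (intro convexD) auto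
  moreover have "u * r + v * r = r" using uv by (simp flip: distrib_right)
  ultimately show "u *\<^sub>R x + v *\<^sub>R y \<in> {p. h p \<le> ereal r}" by simp
qed

lemma edom_eq_Union_sublevel: "edom h = (\<Union>k::nat. {p. h p \<le> ereal (real k)})"
proof -
  have "\<exists>k::nat. h p \<le> ereal (real k)" if "h p < \<infinity>" for p
    using that real_arch_simple by (cases "h p") auto
  then show ?thesis by (auto simp: edom_def intro: le_less_trans)
qed

lemma convex_edom: "ereal_convex h \<Longrightarrow> convex (edom h)"
proof (rule convexI)
  fix x y and u v :: real
  assume h: "ereal_convex h" and xy: "x \<in> edom h" "y \<in> edom h" and uv: "0 \<le> u" "0 \<le> v" "u + v = 1"
  obtain i j :: nat where ij: "h x \<le> ereal i" "h y \<le> ereal j"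
    using xy by (auto simp: edom_eq_Union_sublevel)
  have "h x \<le> ereal (max i j)" "h y \<le> ereal (max i j)"
    using ij by (auto intro: order_trans)
  then have "h (u *\<^sub>R x + v *\<^sub>R y) \<le> ereal (real (max i j))"
    using convexD[OF convex_sublevel[OF h, of "real (max i j)"], of x y u v] uv by simp
  then show "u *\<^sub>R x + v *\<^sub>R y \<in> edom h" by (auto simp: edom_def intro: le_less_trans)
qed

lemma mem_mdiff_prod3:
  "d \<in> mdiff (prod3 P Q) (imA_Delta A) \<longleftrightarrow>
    (\<exists>y ys xs x v. (y, ys) \<in> P \<and> xs \<in> Q \<and> d = (y - blinfun_apply A x, ys - v, xs - (v o\<^sub>L A)))"
  by (force simp: mdiff_def prod3_def imA_Delta_def)

lemma mdiff_prod3_mono: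
  "P \<subseteq> P' \<Longrightarrow> Q \<subseteq> Q' \<Longrightarrow> mdiff (prod3 P Q) E \<subseteq> mdiff (prod3 P' Q') E"
  by (auto simp: mdiff_def prod3_def) blast

text \<open>For a fixed subtracted element the map \<open>f\<close> is affine, so the hulls can be
  pulled out one factor at a time: first in \<open>p\<close> with \<open>q\<close> in
  \<open>Q\<close> fixed, then in \<open>q\<close>. This is what keeps the affine hull unchanged
  when both factors are convexified.\<close>

lemma mdiff_prod3_hull_subset:
  fixes A :: "'x::real_normed_vector \<Rightarrow>\<^sub>L 'y::real_normed_vector"
  shows "mdiff (prod3 (convex hull P) (convex hull Q)) (imA_Delta A)
    \<subseteq> convex hull (mdiff (prod3 P Q) (imA_Delta A))"
proof
  let ?D = "convex hull (mdiff (prod3 P Q) (imA_Delta A))"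
  fix d assume "d \<in> mdiff (prod3 (convex hull P) (convex hull Q)) (imA_Delta A)"
  then obtain y ys xs x v where d: "(y, ys) \<in> convex hull P" "xs \<in> convex hull Q"
      "d = (y - A x, ys - v, xs - (v o\<^sub>L A))"
    unfolding mem_mdiff_prod3 by blast
  define f where "f p q = (fst p - A x, snd p - v, q - (v o\<^sub>L A))" for p :: "'y \<times> 'y dual" and q :: "'x dual"
  have comb: "f (a *\<^sub>R p + b *\<^sub>R p') (a *\<^sub>R q + b *\<^sub>R q') = a *\<^sub>R f p q + b *\<^sub>R f p' q'"
    if "a + b = 1" for a b p p' q q'
  proof -
    have "b = 1 - a" using that by simp
    show ?thesis unfolding \<open>b = 1 - a\<close> by (simp add: f_def algebra_simps)
  qed
  have self: "a *\<^sub>R z + b *\<^sub>R z = z" if "a + b = 1" for a b and z :: "'c::real_vector"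
    using that by (simp flip: scaleR_add_left)
  have "convex {p. f p q \<in> ?D}" for q
  proof (rule convexI)
    fix p p' and a b :: real
    assume "p \<in> {p. f p q \<in> ?D}" "p' \<in> {p. f p q \<in> ?D}" and ab: "0 \<le> a" "0 \<le> b" "a + b = 1"
    then have "a *\<^sub>R f p q + b *\<^sub>R f p' q \<in> ?D" by (intro convexD[OF convex_convex_hull]) auto
    then show "a *\<^sub>R p + b *\<^sub>R p' \<in> {p. f p q \<in> ?D}"
      using comb[OF ab(3), of p p' q q] self[OF ab(3), of q] by simp
  qed
  moreover have "P \<subseteq> {p. f p q \<in> ?D}" if "q \<in> Q" for q
  proof
    fix p assume "p \<in> P"
    then have "f p q \<in> mdiff (prod3 P Q) (imA_Delta A)"
      unfolding mem_mdiff_prod3 f_def using that by (metis prod.collapse)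
    then show "p \<in> {p. f p q \<in> ?D}" by (simp add: hull_inc)
  qed
  ultimately have 1: "f p q \<in> ?D" if "p \<in> convex hull P" "q \<in> Q" for p q
    using hull_minimal[of P "{p. f p q \<in> ?D}" convex] that by blast
  have "convex {q. f (y, ys) q \<in> ?D}"
  proof (rule convexI)
    fix q q' and a b :: real
    assume "q \<in> {q. f (y, ys) q \<in> ?D}" "q' \<in> {q. f (y, ys) q \<in> ?D}" and ab: "0 \<le> a" "0 \<le> b" "a + b = 1"
    then have "a *\<^sub>R f (y, ys) q + b *\<^sub>R f (y, ys) q' \<in> ?D" by (intro convexD[OF convex_convex_hull]) auto
    then show "a *\<^sub>R q + b *\<^sub>R q' \<in> {q. f (y, ys) q \<in> ?D}"
      using comb[OF ab(3), of "(y, ys)" "(y, ys)" q q'] self[OF ab(3), of "(y, ys)"] by simp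
  qed
  then have "convex hull Q \<subseteq> {q. f (y, ys) q \<in> ?D}"
    using 1[OF d(1)] by (intro hull_minimal) auto
  then have "f (y, ys) xs \<in> ?D" using d(2) by blast
  then show "d \<in> ?D" by (simp add: f_def d(3))
qed

text \<open>A point outside \<open>H\<close> would be separated by a functional \<open>f\<close>
  constant on \<open>H\<close>. Its components form an isotropic pair \<open>(bs, b2)\<close> for
  \<open>T\<close> and the trivially isotropic pair \<open>(0, z)\<close> for \<open>S\<close>;
  constancy then spreads to the domains of \<open>hT\<close> and \<open>hS\<close>, contradicting
  the separation.\<close>

lemma mdiff_edom_subset_closed_affine_hull:
  fixes S :: "('x::real_normed_vector \<times> 'x dual) set"
    and T :: "('y::real_normed_vector \<times> 'y dual) set"
    and A :: "'x \<Rightarrow>\<^sub>L 'y"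
  assumes S: "gossez_D S" "representative S hS" and T: "gossez_D T" "representative T hT"
    and H: "affine H" "closed H" "mdiff (prod3 T (range_op S)) (imA_Delta A) \<subseteq> H"
  shows "mdiff (prod3 (edom hT) (snd ` edom hS)) (imA_Delta A) \<subseteq> H"
proof (rule ccontr)
  obtain a0 as0 where T0: "(a0, as0) \<in> T"
    using T(1) maximal_monotone_nonempty[of T] by (auto simp: gossez_D_def)
  obtain s0 ss0 where S0: "(s0, ss0) \<in> S"
    using S(1) maximal_monotone_nonempty[of S] by (auto simp: gossez_D_def)
  have mem: "(a - A x, as - v, ss - (v o\<^sub>L A)) \<in> H" if "(a, as) \<in> T" "(s, ss) \<in> S" for a as s ss x v
  proof -
    have "ss \<in> range_op S" using that by (force simp: range_op_def)
    then have "(a - A x, as - v, ss - (v o\<^sub>L A)) \<in> mdiff (prod3 T (range_op S)) (imA_Delta A)"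
      unfolding mem_mdiff_prod3 using that by blast
    then show ?thesis using H(3) by blast
  qed
  assume "\<not> ?thesis"
  then obtain d where d: "d \<in> mdiff (prod3 (edom hT) (snd ` edom hS)) (imA_Delta A)" "d \<notin> H"
    by blast
  define u where "u = (a0, as0, ss0)"
  have "u \<in> H" using mem[OF T0 S0, of 0 0] by (simp add: u_def)
  then obtain f :: "('y \<times> 'y dual \<times> 'x dual) \<Rightarrow>\<^sub>L real"
    where f: "\<And>v. v \<in> H \<Longrightarrow> f v = f u" "f d \<noteq> f u"
    using closed_affine_separation[OF H(1,2) _ d(2), of u] by blast
  define bs where "bs = Blinfun (\<lambda>y. f (y, 0, 0))"
  define b2 where "b2 = Blinfun (\<lambda>v. f (0, v, 0))"
  define z where "z = Blinfun (\<lambda>w. f (0, 0, w))"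
  have bs: "bs y = f (y, 0, 0)" for y unfolding bs_def
    by (subst bounded_linear_Blinfun_apply)
      (intro bounded_linear_compose[OF blinfun.bounded_linear_right]
        bounded_linear_Pair bounded_linear_ident bounded_linear_zero, rule refl)
  have b2: "b2 y = f (0, y, 0)" for y unfolding b2_def
    by (subst bounded_linear_Blinfun_apply)
      (intro bounded_linear_compose[OF blinfun.bounded_linear_right]
        bounded_linear_Pair bounded_linear_ident bounded_linear_zero, rule refl)
  have z: "z y = f (0, 0, y)" for y unfolding z_def
    by (subst bounded_linear_Blinfun_apply)
      (intro bounded_linear_compose[OF blinfun.bounded_linear_right]
        bounded_linear_Pair bounded_linear_ident bounded_linear_zero, rule refl)
  have split: "f (y, v, w) = bs y + b2 v + z w" for y v w
    unfolding bs b2 z by (simp flip: blinfun.add_right)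
  have const: "bs a - bs (A x) + (b2 as - b2 v) + (z ss - z (v o\<^sub>L A)) = f u"
    if "(a, as) \<in> T" "(s, ss) \<in> S" for a as s ss x v
    using f(1)[OF mem[OF that, of x v]] by (simp add: split blinfun.diff_right)
  \<comment> \<open>Varying one of the free parameters \<open>x\<close> and \<open>v\<close> at a
    time shows that \<open>f\<close> vanishes on the linear space
    \<open>imA_Delta A\<close>.\<close>
  have bsA: "bs (A x) = 0" for x
    using const[OF T0 S0, of x 0] const[OF T0 S0, of 0 0] by simp
  have b2z: "b2 v = - z (v o\<^sub>L A)" for v
    using const[OF T0 S0, of 0 v] const[OF T0 S0, of 0 0] by simp
  have "bs o\<^sub>L A = 0" by (rule blinfun_eqI) (simp add: bsA)
  \<comment> \<open>This is \<open>b2z\<close> at \<open>bs\<close>, whose composition with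
    \<open>A\<close> is zero.\<close>
  then have iso: "b2 bs = 0" by (simp add: b2z)
  have cT: "bs y + b2 ys = f u - z ss0" if "(y, ys) \<in> edom hT" for y ys
    by (rule isotropic_constant_on_edom[OF T iso _ that])
      (use const[OF _ S0, of _ _ 0 0] in \<open>simp add: algebra_simps\<close>)
  have zS: "z ss = z ss0" if "(s, ss) \<in> S" for s ss
    using const[OF T0 that, of 0 0] const[OF T0 S0, of 0 0] by simp
  have cS: "blinfun_apply (0 :: 'x dual) x + z xs = z ss0" if "(x, xs) \<in> edom hS" for x xs
    by (rule isotropic_constant_on_edom[OF S _ _ that])
      (use zS in auto)
  obtain y ys x xs x' v where "(y, ys) \<in> edom hT" "(x, xs) \<in> edom hS"
      "d = (y - A x', ys - v, xs - (v o\<^sub>L A))"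
    using d(1) unfolding mem_mdiff_prod3 by fastforce
  \<comment> \<open>The contributions of \<open>x'\<close> and \<open>v\<close> cancel by
    \<open>bsA\<close> and \<open>b2z\<close>, leaving the two constants found above.\<close>
  then have "f d = f u"
    using cT[of y ys] cS[of x xs] by (simp add: split blinfun.diff_right bsA b2z[of v])
  then show False using f(2) by simp
qed

text \<open>Projections of closed sublevel sets need not be closed, so the first coordinate of
  \<open>hS\<close> is kept as a variable that \<open>L\<close> forgets, and
  \<open>imA_Delta A\<close> is likewise parametrised. On this product space the common sublevel
  sets are closed, convex and increasing.\<close>

lemma icr_mdiff_edom_subset_rel_interior:
  fixes hS :: "'x::banach \<times> 'x dual \<Rightarrow> ereal" and hT :: "'y::banach \<times> 'y dual \<Rightarrow> ereal"
    and A :: "'x \<Rightarrow>\<^sub>L 'y"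
  assumes S: "ereal_convex hS" "ereal_lsc hS" and T: "ereal_convex hT" "ereal_lsc hT"
    and D: "D = mdiff (prod3 (edom hT) (snd ` edom hS)) (imA_Delta A)"
    and ne: "D \<noteq> {}" and cl: "closed (affine hull D)"
  shows "icr D \<subseteq> rel_interior D"
proof
  fix u assume u: "u \<in> icr D"
  define L :: "('y \<times> 'y dual) \<times> ('x \<times> 'x dual) \<times> 'x \<times> 'y dual \<Rightarrow> 'y \<times> 'y dual \<times> 'x dual"
    where "L = (\<lambda>p. (fst (fst p) - A (fst (snd (snd p))), snd (fst p) - snd (snd (snd p)),
      snd (fst (snd p)) - (snd (snd (snd p)) o\<^sub>L A)))"
  define C :: "nat \<Rightarrow> (('y \<times> 'y dual) \<times> ('x \<times> 'x dual) \<times> 'x \<times> 'y dual) set"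
    where "C k = {p. hT p \<le> ereal k} \<times> {p. hS p \<le> ereal k} \<times> UNIV" for k
  show "u \<in> rel_interior D"
  proof (rule icr_subset_rel_interior_image[OF _ _ _ _ _ ne cl u])
    show "bounded_linear L" unfolding L_def
      by (intro bounded_linear_Pair bounded_linear_sub
          bounded_linear_compose[OF blinfun.bounded_linear_right]
          bounded_linear_compose[OF bounded_bilinear.bounded_linear_left[OF bounded_bilinear_blinfun_compose]]
          bounded_linear_fst_comp bounded_linear_snd_comp bounded_linear_ident)
    show "closed (C k)" for k
      using S T by (auto simp: C_def ereal_lsc_def intro!: closed_Times)
    show "convex (C k)" for k
      using convex_sublevel[OF S(1)] convex_sublevel[OF T(1)] by (auto simp: C_def intro!: convex_Times)
    show "incseq C"
      by (auto simp: incseq_def C_def intro: order_trans)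
    have U: "(\<Union>k. C k) = edom hT \<times> edom hS \<times> UNIV"
    proof -
      have "\<exists>k::nat. hT p \<le> ereal k \<and> hS q \<le> ereal k" if pq: "p \<in> edom hT" "q \<in> edom hS" for p q
      proof -
        obtain i j :: nat where "hT p \<le> ereal i" "hS q \<le> ereal j"
          using pq by (auto simp: edom_eq_Union_sublevel)
        then show ?thesis by (intro exI[of _ "max i j"]) (auto intro: order_trans)
      qed
      moreover have "C k \<subseteq> edom hT \<times> edom hS \<times> UNIV" for k
        by (auto simp: C_def edom_eq_Union_sublevel)
      ultimately show ?thesis by (intro equalityI UN_least) (auto simp: C_def)
    qed
    show "D = L ` (\<Union>k. C k)"
      unfolding U
    proof (intro equalityI subsetI)
      fix d assume "d \<in> D"
      then obtain y ys xs x' v x where d: "(y, ys) \<in> edom hT" "(x, xs) \<in> edom hS"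
          "d = (y - A x', ys - v, xs - (v o\<^sub>L A))"
        unfolding D mem_mdiff_prod3 by fastforce
      then have "d = L ((y, ys), (x, xs), x', v)" by (simp add: L_def)
      then show "d \<in> L ` (edom hT \<times> edom hS \<times> UNIV)" using d by blast
    next
      fix d assume "d \<in> L ` (edom hT \<times> edom hS \<times> UNIV)"
      then obtain y ys xs x' v x where d: "(y, ys) \<in> edom hT" "(x, xs) \<in> edom hS"
          "d = L ((y, ys), (x, xs), x', v)"
        by auto
      then have "d = (y - A x', ys - v, xs - (v o\<^sub>L A))" by (simp add: L_def)
      moreover have "xs \<in> snd ` edom hS" using d(2) by force
      ultimately show "d \<in> D" using d(1) unfolding D mem_mdiff_prod3 by blast
    qed
  qed
qed

theorem theorem3p4:
  fixes S :: "('x::banach \<times> 'x dual) set"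
    and T :: "('y::banach \<times> 'y dual) set"
    and hS :: "'x \<times> 'x dual \<Rightarrow> ereal"
    and hT :: "'y \<times> 'y dual \<Rightarrow> ereal"
    and A :: "'x \<Rightarrow>\<^sub>L 'y"
  assumes "\<exists>x::'x. x \<noteq> 0" and "\<exists>y::'y. y \<noteq> 0"
    and "gossez_D S" and "gossez_D T"
    and "strong_representative S hS" and "strong_representative T hT"
    and "prod3 (edom hT) (snd ` edom hS) \<inter> imA_Delta A \<noteq> {}"
  shows "ic (mdiff (prod3 T (range_op S)) (imA_Delta A))
           \<subseteq> ic (mdiff (prod3 (convex hull T) (convex hull (range_op S))) (imA_Delta A))
       \<and> ic (mdiff (prod3 (convex hull T) (convex hull (range_op S))) (imA_Delta A))
           \<subseteq> ic (mdiff (prod3 (edom hT) (snd ` edom hS)) (imA_Delta A))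
       \<and> ic (mdiff (prod3 (edom hT) (snd ` edom hS)) (imA_Delta A))
           = ri (mdiff (prod3 (edom hT) (snd ` edom hS)) (imA_Delta A))"
proof -
  let ?D1 = "mdiff (prod3 T (range_op S)) (imA_Delta A)"
  let ?D2 = "mdiff (prod3 (convex hull T) (convex hull (range_op S))) (imA_Delta A)"
  let ?D3 = "mdiff (prod3 (edom hT) (snd ` edom hS)) (imA_Delta A)"
  have repS: "representative S hS" and repT: "representative T hT"
    using assms by (auto simp: strong_representative_def)
  have S: "ereal_convex hS" "ereal_lsc hS" "S \<subseteq> edom hS"
    using repS by (auto simp: representative_def edom_def)
  have T: "ereal_convex hT" "ereal_lsc hT" "T \<subseteq> edom hT"
    using repT by (auto simp: representative_def edom_def)
  have "S \<noteq> {}" "T \<noteq> {}"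
    using assms(3,4) maximal_monotone_nonempty by (auto simp: gossez_D_def)
  then obtain y ys x xs where "(y, ys) \<in> T" "(x, xs) \<in> S" by auto
  then have "(y, ys) \<in> T" "xs \<in> range_op S" by (force simp: range_op_def)+
  then have "(y - A 0, ys - 0, xs - (0 o\<^sub>L A)) \<in> ?D1"
    unfolding mem_mdiff_prod3 by blast
  then have ne1: "?D1 \<noteq> {}" by blast
  have D12: "?D1 \<subseteq> ?D2" by (intro mdiff_prod3_mono hull_subset)
  have "convex (snd ` edom hS)"
    by (intro convex_linear_image convex_edom S linear_snd)
  then have D23: "?D2 \<subseteq> ?D3"
    using S T by (intro mdiff_prod3_mono hull_minimal convex_edom) (auto simp: range_op_def)
  have "?D2 \<subseteq> affine hull ?D1"
    using mdiff_prod3_hull_subset convex_hull_subset_affine_hull by (rule order_trans)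
  then have aff12: "affine hull ?D1 = affine hull ?D2"
    by (intro equalityI[OF hull_mono[OF D12] hull_minimal] affine_affine_hull)
  have "ic ?D2 \<subseteq> ic ?D3"
  \<comment> \<open>Without a closed affine hull the left side is empty by definition of
    \<open>ic\<close>; otherwise that hull already contains \<open>?D3\<close>, so the affine hulls
    coincide.\<close>
  proof (cases "closed (affine hull ?D2)")
    case True
    have "?D1 \<subseteq> affine hull ?D2" using D12 hull_subset by (rule order_trans)
    then have "?D3 \<subseteq> affine hull ?D2"
      by (rule mdiff_edom_subset_closed_affine_hull[OF assms(3) repS assms(4) repT affine_affine_hull True])
    then have "affine hull ?D2 = affine hull ?D3"
      by (intro equalityI[OF hull_mono[OF D23] hull_minimal] affine_affine_hull)
    then show ?thesis using ne1 D12 D23 by (intro ic_mono) auto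
  qed (simp add: ic_def)
  moreover have "ic ?D3 = ri ?D3"
  proof -
    have "?D3 \<noteq> {}" using ne1 D12 D23 by blast
    then have "icr ?D3 = rel_interior ?D3" if "closed (affine hull ?D3)"
      using icr_mdiff_edom_subset_rel_interior[OF S(1,2) T(1,2) refl _ that]
      by (intro equalityI rel_interior_subset_icr)
    \<comment> \<open>If the affine hull is not closed, both sides are empty.\<close>
    then show ?thesis by (simp add: ic_def ri_def)
  qed
  ultimately show ?thesis using ic_mono[OF ne1 D12 aff12] by blast
qed

end
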